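(* Let $n\ge1$ and let $X_1,X_2,\ldots,X_n$ be independent random variables taking values in $\{0,1\}$ with $\Pr(X_i=1)=p_i$ and $\Pr(X_i=0)=1-p_i$, where $0\le p_i\le 1$ for $i=1,2,\ldots,n$. Then the Shannon entropy of the random variable $X_1+X_2+\cdots+X_n$ is maximal when $p_i=1/2$ for all $i=1,2,\ldots,n$; that is, $$\max_{0\le p_1,p_2,\ldots,p_n\le 1}H\Bigl(\sum_{i=1}^nX_i\Bigr)=H_n(1/2).$$
   Context: $H(Z)=-\sum_k\Pr(Z=k)\log_2\Pr(Z=k)$ denotes the Shannon entropy (in bits) of a discrete random variable $Z$, with the convention $0\log 0=0$. $H_n(p)$ denotes the Shannon entropy of the binomial distribution with $n$ independent trials and success probability $p$: $$H_n(p)=-\sum_{k=0}^n\binom nk p^k(1-p)^{n-k}\log_2\Bigl(\binom nk p^k(1-p)^{n-k}\Bigr).$$ *)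

theory Defs
  imports "HOL-Probability.Probability"
begin

(* Entropy of a discrete random variable: the library's \<H>(Z) with base 2. *)
abbreviation shannon_entropy :: "'a measure \<Rightarrow> ('a \<Rightarrow> 'b) \<Rightarrow> real" where
  "shannon_entropy M Z \<equiv> prob_space.entropy M 2 (count_space (Z ` space M)) Z"

(* Since log 2 0 = 0 in HOL (and the factor is 0 anyway), the convention 0 log 0 = 0 is built in. *)
lemma shannon_entropy_eq_sum:
  assumes "prob_space M" and "simple_function M Z"
  shows "shannon_entropy M Z =
    - (\<Sum>k\<in>Z ` space M. measure M {\<omega> \<in> space M. Z \<omega> = k} * log 2 (measure M {\<omega> \<in> space M. Z \<omega> = k}))"
proof -
  interpret prob_space M by fact
  interpret information_space M 2 by unfold_locales simp
  have "simple_distributed M Z (\<lambda>k. measure M {\<omega> \<in> space M. Z \<omega> = k})"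
    by (rule simple_distributedI[OF assms(2)])
      (auto simp: measure_nonneg intro!: arg_cong[where f = "measure M"])
  then show ?thesis
    by (rule entropy_simple_distributed)
qed

definition binomial_entropy :: "nat \<Rightarrow> real \<Rightarrow> real" where
  "binomial_entropy n p =
    - (\<Sum>k = 0..n. (real (n choose k) * p ^ k * (1 - p) ^ (n - k)) *
        log 2 (real (n choose k) * p ^ k * (1 - p) ^ (n - k)))"

(* X 1, ..., X n are independent 0/1-valued random variables on M with P(X i = 1) = p i.
   Indices outside {1..n} are irrelevant. Independence includes measurability of each X i. *)
definition indep_bernoulli ::
    "'a measure \<Rightarrow> nat \<Rightarrow> (nat \<Rightarrow> real) \<Rightarrow> (nat \<Rightarrow> 'a \<Rightarrow> nat) \<Rightarrow> bool" where
  "indep_bernoulli M n p X \<longleftrightarrow>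
    prob_space M \<and>
    prob_space.indep_vars M (\<lambda>_. count_space UNIV) X {1..n} \<and>
    (\<forall>i\<in>{1..n}.
      (\<forall>\<omega>\<in>space M. X i \<omega> \<in> {0, 1}) \<and>
      measure M {\<omega> \<in> space M. X i \<omega> = 1} = p i \<and>
      measure M {\<omega> \<in> space M. X i \<omega> = 0} = 1 - p i)"

definition is_maximum :: "real set \<Rightarrow> real \<Rightarrow> bool" where
  "is_maximum V m \<longleftrightarrow> m \<in> V \<and> (\<forall>v\<in>V. v \<le> m)"

end

theory Submission
  imports Defs
begin

text \<open>
  The probabilities of \<open>X\<^sub>1 + \<dots> + X\<^sub>n\<close> are the coefficients of \<open>\<Prod>i. (1 - p\<^sub>i) + p\<^sub>i x\<close>, and
  these are log-concave.  For a fixed sum of two parameters, log-concavity and Gibbs' inequality show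
  that the entropy grows with their product.  As in the smoothing proof of AM-GM, the entropy is
  therefore at most that of the binomial distribution with the mean parameter \<open>q\<close>.
  The latter has derivative \<open>n (ln (1 - q) - ln q + E ln ((K + 1) / (n - K)))\<close> in \<open>q\<close>, with \<open>K\<close>
  binomial for \<open>n - 1\<close> and \<open>q\<close>.  The bracket vanishes at \<open>1/2\<close> by symmetry and is decreasing in
  \<open>q\<close>, because \<open>ln ((j + 1) / j) \<le> 1 / j\<close> and the mean of \<open>1 / (K + 1)\<close> can be computed.
\<close>

section \<open>Equalizing the parameters\<close>

text \<open>The case \<open>k = l\<close> is the usual inequality. Allowing \<open>k \<le> l\<close>
  also rules out internal zeros, and this stronger form is what survives multiplication by a linear
  factor.\<close>

definition log_concave :: "(nat \<Rightarrow> real) \<Rightarrow> bool" where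
  "log_concave c \<longleftrightarrow>
    (\<forall>k. 0 \<le> c k) \<and> (\<forall>k l. k \<le> l \<longrightarrow> c k * c (l + 2) \<le> c (k + 1) * c (l + 1))"

text \<open>Natural logarithms keep the derivatives free of constants; division by
  \<open>ln 2\<close> recovers bits.\<close>

definition entropy_nats :: "nat \<Rightarrow> (nat \<Rightarrow> real) \<Rightarrow> real" where
  "entropy_nats n c = - (\<Sum>k\<le>n. c k * ln (c k))"

section \<open>Log-concavity of products of linear factors\<close>

lemma coeff_linear_mult:
  "coeff ([:a, b:] * P) k = a * coeff P k + b * (case k of 0 \<Rightarrow> 0 | Suc j \<Rightarrow> coeff P j)"
  for P :: "real poly"
  by (simp add: coeff_pCons split: nat.split)

text \<open>Expand both sides in \<open>a * a\<close>, \<open>a * b\<close> and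
  \<open>b * b\<close>. One mixed term cancels, and the inequality then holds separately for each of
  the three monomials.\<close>

lemma log_concave_linear_mult:
  fixes P :: "real poly"
  assumes "log_concave (coeff P)" "0 \<le> a" "0 \<le> b"
  shows "log_concave (coeff ([:a, b:] * P))"
proof -
  define c where "c = coeff P"
  have c0: "0 \<le> c k" for k using assms(1) by (auto simp: log_concave_def c_def)
  have lc: "c k * c (Suc (Suc l)) \<le> c (Suc k) * c (Suc l)" if "k \<le> l" for k l
    using assms(1) that by (auto simp: log_concave_def c_def)
  have "coeff ([:a, b:] * P) k * coeff ([:a, b:] * P) (l + 2) \<le>
      coeff ([:a, b:] * P) (k + 1) * coeff ([:a, b:] * P) (l + 1)" if kl: "k \<le> l" for k l
  proof (cases k)
    case 0
    have "a * a * (c 0 * c (Suc (Suc l))) \<le> a * a * (c 1 * c (Suc l))"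
      using lc[of 0 l] assms by (intro mult_left_mono) auto
    moreover have "0 \<le> a * b * (c 1 * c l)" "0 \<le> b * b * (c 0 * c l)"
      using assms c0 by simp_all
    ultimately show ?thesis
      by (simp only: coeff_linear_mult c_def[symmetric] 0) (simp add: algebra_simps)
  next
    case (Suc j)
    then obtain i where l: "l = Suc i" and ji: "j \<le> i"
      using kl Suc by (cases l) auto
    have 1: "a * a * (c k * c (Suc (Suc l))) \<le> a * a * (c (Suc k) * c (Suc l))"
      using lc[OF kl] assms by (intro mult_left_mono) auto
    have 2: "b * b * (c j * c (Suc l)) \<le> b * b * (c k * c l)"
      using lc[OF ji] assms l Suc by (intro mult_left_mono) auto
    have "c j * c (Suc (Suc l)) \<le> c (Suc j) * c (Suc l)"
      using lc[of j l] ji l by simp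
    \<comment> \<open>For \<open>j = i\<close>, that is \<open>k = l\<close>, both sides agree up to
      order; otherwise \<open>k \<le> i\<close> and log-concavity applies again.\<close>
    also have "\<dots> \<le> c (Suc k) * c l"
      using lc[of k i] l Suc kl by (cases "j = i") (auto simp: mult.commute)
    finally have 3: "a * b * (c j * c (Suc (Suc l))) \<le> a * b * (c (Suc k) * c l)"
      using assms by (intro mult_left_mono) auto
    show ?thesis
      using 1 2 3 by (simp only: coeff_linear_mult c_def[symmetric] Suc l) (simp add: algebra_simps)
  qed
  moreover have "0 \<le> coeff ([:a, b:] * P) k" for k
    using assms(2,3) c0 by (auto simp only: coeff_linear_mult c_def[symmetric]
        split: nat.split intro!: add_nonneg_nonneg mult_nonneg_nonneg)
  ultimately show ?thesis by (simp add: log_concave_def)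
qed

lemma log_concave_prod_linear:
  fixes p :: "'i \<Rightarrow> real"
  assumes "finite A" "\<And>i. i \<in> A \<Longrightarrow> 0 \<le> p i \<and> p i \<le> 1"
  shows "log_concave (coeff (\<Prod>i\<in>A. [:1 - p i, p i:]))"
  using assms
proof (induction A rule: finite_induct)
  case empty
  show ?case by (auto simp: log_concave_def coeff_1)
next
  case (insert i A)
  then show ?case
    unfolding prod.insert[OF insert.hyps(1,2)] by (intro log_concave_linear_mult) auto
qed

section \<open>Comparison of two pairs of parameters\<close>

text \<open>The adjoint of multiplication by a linear factor. With \<open>[:1, -1:]\<close> it is
  summation by parts; with \<open>[:1 - x, x:]\<close> it is conditioning on one trial.\<close>

lemma sum_coeff_linear_mult:
  fixes P :: "real poly"
  assumes "degree P \<le> m"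
  shows "(\<Sum>k\<le>Suc m. coeff ([:a, b:] * P) k * L k) =
    (\<Sum>k\<le>m. coeff P k * (a * L k + b * L (Suc k)))"
proof -
  have "(\<Sum>k\<le>Suc m. coeff ([:a, b:] * P) k * L k) =
     (\<Sum>k\<le>Suc m. a * coeff P k * L k) +
     (\<Sum>k\<le>Suc m. b * (case k of 0 \<Rightarrow> 0 | Suc j \<Rightarrow> coeff P j) * L k)"
    by (simp only: coeff_linear_mult sum.distrib[symmetric] distrib_right)
  also have "(\<Sum>k\<le>Suc m. a * coeff P k * L k) = (\<Sum>k\<le>m. a * coeff P k * L k)"
    using assms by (simp add: coeff_eq_0)
  also have "(\<Sum>k\<le>Suc m. b * (case k of 0 \<Rightarrow> 0 | Suc j \<Rightarrow> coeff P j) * L k) =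
      (\<Sum>k\<le>m. b * coeff P k * L (Suc k))"
    by (simp add: sum.atMost_Suc_shift del: sum.atMost_Suc)
  finally show ?thesis by (simp add: sum.distrib[symmetric] algebra_simps)
qed

text \<open>Sum \<open>ln t \<le> t - 1\<close> at \<open>t = v k / u k\<close> with weights
  \<open>u k\<close>. The support condition matters since \<open>ln 0 = 0\<close>, where the true
  value would be minus infinity.\<close>

lemma gibbs_inequality:
  fixes u v :: "nat \<Rightarrow> real"
  assumes "\<And>k. 0 \<le> u k" "\<And>k. 0 \<le> v k" "\<And>k. v k = 0 \<Longrightarrow> u k = 0"
    and "(\<Sum>k\<le>n. v k) = (\<Sum>k\<le>n. u k)"
  shows "entropy_nats n u \<le> - (\<Sum>k\<le>n. u k * ln (v k))"
proof -
  have "u k * ln (v k) - u k * ln (u k) \<le> v k - u k" for k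
  proof (cases "u k = 0")
    case False
    then have pos: "u k > 0" "v k > 0"
      using assms(1-3)[of k] by (auto simp: less_le)
    have "u k * ln (v k / u k) \<le> u k * (v k / u k - 1)"
      using pos by (intro mult_left_mono ln_le_minus_one) auto
    then show ?thesis using pos by (simp add: ln_div algebra_simps)
  qed (use assms(2)[of k] in simp)
  then have "(\<Sum>k\<le>n. u k * ln (v k) - u k * ln (u k)) \<le> (\<Sum>k\<le>n. v k - u k)"
    by (intro sum_mono)
  then show ?thesis using assms(4) by (simp add: entropy_nats_def sum_subtractf)
qed

text \<open>The entropy of \<open>[:1 - a, a:] * [:1 - b, b:] * R\<close> depends, for a fixed sum \<open>a + b\<close>, on
  the product \<open>t = a * b\<close> only, and the coefficients are affine in \<open>t\<close> with slope the second
  difference of those of \<open>R\<close>.  Summation by parts moves this difference to the logarithms of the new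
  coefficients, where log-concavity determines the sign.\<close>
lemma entropy_mono_product:
  fixes R :: "real poly"
  assumes R: "log_concave (coeff R)" "degree R \<le> m"
    and ab: "0 \<le> a" "a \<le> 1" "0 \<le> b" "b \<le> 1"
    and cd: "0 < c" "c < 1" "0 < d" "d < 1"
    and sum_eq: "a + b = c + d" and le: "a * b \<le> c * d"
  shows "entropy_nats (m + 2) (coeff ([:1 - a, a:] * ([:1 - b, b:] * R)))
    \<le> entropy_nats (m + 2) (coeff ([:1 - c, c:] * ([:1 - d, d:] * R)))"
proof -
  define u where "u = coeff ([:1 - a, a:] * ([:1 - b, b:] * R))"
  define v where "v = coeff ([:1 - c, c:] * ([:1 - d, d:] * R))"
  define r where "r = coeff R"
  have lcu: "log_concave u" and lcv: "log_concave v"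
    unfolding u_def v_def using ab cd by (intro log_concave_linear_mult R; simp)+
  have u0: "0 \<le> u k" and v0: "0 \<le> v k" and r0: "0 \<le> r k" for k
    using lcu lcv R by (auto simp: log_concave_def r_def)
  have "[:1 - c, c:] * [:1 - d, d:] - [:1 - a, a:] * [:1 - b, b:] =
      smult (c * d - a * b) ([:1, -1:] * [:1, -1:])"
    using sum_eq by (simp add: algebra_simps)
  then have "[:1 - c, c:] * ([:1 - d, d:] * R) - [:1 - a, a:] * ([:1 - b, b:] * R) =
      smult (c * d - a * b) ([:1, -1:] * ([:1, -1:] * R))"
    by (metis (no_types, lifting) left_diff_distrib mult.assoc mult_smult_left)
  then have diff: "v k - u k = (c * d - a * b) * coeff ([:1, -1:] * ([:1, -1:] * R)) k" for k
    unfolding u_def v_def by (metis coeff_diff coeff_smult)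
  have "degree ([:1, -1:] * R) \<le> degree [:1, -1::real:] + degree R"
    by (rule degree_mult_le)
  then have deg: "degree ([:1, -1:] * R) \<le> Suc m"
    using R(2) by simp
  have parts: "(\<Sum>k\<le>m + 2. (v k - u k) * L k) =
      (c * d - a * b) * (\<Sum>k\<le>m. r k * (L k - 2 * L (Suc k) + L (Suc (Suc k))))" for L
  proof -
    have "(\<Sum>k\<le>m + 2. (v k - u k) * L k) =
        (c * d - a * b) * (\<Sum>k\<le>Suc (Suc m). coeff ([:1, -1:] * ([:1, -1:] * R)) k * L k)"
      unfolding diff by (simp only: sum_distrib_left mult.assoc add_2_eq_Suc')
    also have "(\<Sum>k\<le>Suc (Suc m). coeff ([:1, -1:] * ([:1, -1:] * R)) k * L k) =
        (\<Sum>k\<le>m. r k * (L k - 2 * L (Suc k) + L (Suc (Suc k))))"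
      unfolding sum_coeff_linear_mult[OF deg] sum_coeff_linear_mult[OF R(2)] r_def
      by (simp add: algebra_simps)
    finally show ?thesis .
  qed
  have expand: "coeff ([:1 - x, x:] * ([:1 - y, y:] * R)) k =
      (1 - x) * (1 - y) * r k
      + (if k \<ge> 1 then ((1 - x) * y + x * (1 - y)) * r (k - 1) else 0)
      + (if k \<ge> 2 then x * y * r (k - 2) else 0)" for x y k
    unfolding coeff_linear_mult r_def[symmetric] by (auto split: nat.split simp: algebra_simps)
  \<comment> \<open>As \<open>c\<close> and \<open>d\<close> lie strictly between 0 and 1, all three
    coefficients of their quadratic factor are positive.\<close>
  have v_pos: "v k > 0" "v (Suc k) > 0" "v (Suc (Suc k)) > 0" if "r k > 0" for k
  proof -
    have cd': "0 < (1 - c) * (1 - d)" "0 < (1 - c) * d + c * (1 - d)" "0 < c * d"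
      using cd by (auto intro!: add_pos_pos)
    have "(1 - c) * (1 - d) * r k \<le> v k"
      "((1 - c) * d + c * (1 - d)) * r k \<le> v (Suc k)"
      "c * d * r k \<le> v (Suc (Suc k))"
      unfolding v_def expand using cd r0 by (auto intro!: add_nonneg_nonneg mult_nonneg_nonneg)
    then show "v k > 0" "v (Suc k) > 0" "v (Suc (Suc k)) > 0"
      using cd' that by (meson less_le_trans mult_pos_pos)+
  qed
  \<comment> \<open>\<open>u k\<close> is built from \<open>r k\<close>, \<open>r (k - 1)\<close>
    and \<open>r (k - 2)\<close> only, and by \<open>v_pos\<close> each of these vanishes with
    \<open>v k\<close>.\<close>
  have supp: "u k = 0" if "v k = 0" for k
  proof -
    have "r k = 0"
      using v_pos(1)[of k] r0[of k] that by (auto simp: less_le)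
    moreover have "r (k - 1) = 0" if "k \<ge> 1"
      using v_pos(2)[of "k - 1"] r0[of "k - 1"] \<open>v k = 0\<close> that by (auto simp: less_le)
    moreover have "r (k - 2) = 0" if "k \<ge> 2"
      using v_pos(3)[of "k - 2"] r0[of "k - 2"] \<open>v k = 0\<close> that
      by (auto simp: less_le Suc_diff_Suc numeral_2_eq_2)
    ultimately show ?thesis unfolding u_def expand by auto
  qed
  have "r k * (ln (v k) - 2 * ln (v (Suc k)) + ln (v (Suc (Suc k)))) \<le> 0" for k
  proof (cases "r k = 0")
    case False
    then have pos: "r k > 0" using r0[of k] by simp
    note vp = v_pos[OF pos]
    have "v k * v (Suc (Suc k)) \<le> v (Suc k) * v (Suc k)"
      using lcv by (auto simp: log_concave_def dest!: spec[of _ k])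
    then have "ln (v k * v (Suc (Suc k))) \<le> ln (v (Suc k) * v (Suc k))"
      using vp by (intro ln_mono) auto
    then have "ln (v k) - 2 * ln (v (Suc k)) + ln (v (Suc (Suc k))) \<le> 0"
      using vp by (simp add: ln_mult)
    then show ?thesis using pos by (intro mult_nonneg_nonpos) auto
  qed simp
  then have "(\<Sum>k\<le>m. r k * (ln (v k) - 2 * ln (v (Suc k)) + ln (v (Suc (Suc k))))) \<le> 0"
    by (intro sum_nonpos) auto
  \<comment> \<open>Hence the cross entropy of \<open>u\<close> relative to \<open>v\<close> is at
    most the entropy of \<open>v\<close>; Gibbs' inequality bounds the entropy of \<open>u\<close>
    by that cross entropy.\<close>
  then have "(\<Sum>k\<le>m + 2. (v k - u k) * ln (v k)) \<le> 0"
    unfolding parts using le by (intro mult_nonneg_nonpos) auto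
  moreover have "entropy_nats (m + 2) u \<le> - (\<Sum>k\<le>m + 2. u k * ln (v k))"
    \<comment> \<open>Constants have zero second difference, so \<open>u\<close> and
      \<open>v\<close> have equal total mass.\<close>
    using parts[of "\<lambda>_. 1"] supp u0 v0
    by (intro gibbs_inequality) (auto simp: sum_subtractf)
  ultimately show ?thesis
    unfolding u_def[symmetric] v_def[symmetric]
    by (simp add: entropy_nats_def left_diff_distrib sum_subtractf)
qed

section \<open>Smoothing to equal parameters\<close>

lemma degree_prod_linear_le:
  fixes p :: "'i \<Rightarrow> real"
  assumes "finite A"
  shows "degree (\<Prod>i\<in>A. [:1 - p i, p i:]) \<le> card A"
proof -
  have "degree (\<Prod>i\<in>A. [:1 - p i, p i:]) \<le> (\<Sum>i\<in>A. degree [:1 - p i, p i:])"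
    using degree_prod_sum_le[OF assms, of "\<lambda>i. [:1 - p i, p i:]"] by (simp add: o_def)
  also have "\<dots> \<le> (\<Sum>i\<in>A. 1)"
    by (intro sum_mono) auto
  finally show ?thesis by simp
qed

text \<open>Induction on the number of parameters different from \<open>q\<close>: one below and one
  above \<open>q\<close> are moved, keeping their sum, so that one of them becomes
  \<open>q\<close>.\<close>

lemma entropy_prod_linear_le_power:
  fixes p :: "'i \<Rightarrow> real"
  assumes "finite A" "\<And>i. i \<in> A \<Longrightarrow> 0 \<le> p i \<and> p i \<le> 1"
    and "(\<Sum>i\<in>A. p i) = real (card A) * q"
  shows "entropy_nats (card A) (coeff (\<Prod>i\<in>A. [:1 - p i, p i:]))
    \<le> entropy_nats (card A) (coeff ([:1 - q, q:] ^ card A))"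
  using assms(2,3)
proof (induction "card {i \<in> A. p i \<noteq> q}" arbitrary: p rule: less_induct)
  case less
  show ?case
  proof (cases "\<forall>i\<in>A. p i = q")
    case True
    then have "(\<Prod>i\<in>A. [:1 - p i, p i:]) = (\<Prod>i\<in>A. [:1 - q, q:])"
      by (intro prod.cong) auto
    then show ?thesis by simp
  next
    case False
    have sum0: "(\<Sum>i\<in>A. p i - q) = 0"
      using less.prems(2) by (simp add: sum_subtractf)
    have "\<exists>i\<in>A. p i < q"
    proof (rule ccontr)
      assume "\<not> ?thesis"
      then have "\<forall>i\<in>A. 0 \<le> p i - q" by auto
      then have "\<forall>i\<in>A. p i - q = 0"
        using sum0 sum_nonneg_eq_0_iff[OF assms(1), of "\<lambda>i. p i - q"] by auto
      then show False using False by auto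
    qed
    then obtain i where i: "i \<in> A" "p i < q" by blast
    have sum0': "(\<Sum>i\<in>A. q - p i) = 0"
      using less.prems(2) by (simp add: sum_subtractf)
    have "\<exists>j\<in>A. p j > q"
    proof (rule ccontr)
      assume "\<not> ?thesis"
      then have "\<forall>i\<in>A. 0 \<le> q - p i" by auto
      then have "\<forall>i\<in>A. q - p i = 0"
        using sum0' sum_nonneg_eq_0_iff[OF assms(1), of "\<lambda>i. q - p i"] by auto
      then show False using False by auto
    qed
    then obtain j where j: "j \<in> A" "p j > q" by blast
    define p' where "p' = p(i := q, j := p i + p j - q)"
    define B where "B = A - {i, j}"
    have ij: "i \<noteq> j" using i j by auto
    have B: "finite B" "i \<notin> B" "j \<notin> B" "A = insert i (insert j B)"
      using i j assms(1) by (auto simp: B_def)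
    have cardA: "card A = card B + 2" using B ij by simp
    define R where "R = (\<Prod>i\<in>B. [:1 - p i, p i:])"
    have p'B: "p' k = p k" if "k \<in> B" for k using that B by (auto simp: p'_def)
    have R': "(\<Prod>i\<in>B. [:1 - p' i, p' i:]) = R"
      unfolding R_def using p'B by (intro prod.cong) auto
    have pij: "0 \<le> p i" "p i \<le> 1" "0 \<le> p j" "p j \<le> 1"
      using less.prems(1) i j by auto
    have R1: "log_concave (coeff R)" "degree R \<le> card B"
      unfolding R_def using less.prems(1) B
      by (auto intro!: log_concave_prod_linear degree_prod_linear_le)
    have "0 \<le> (q - p i) * (p j - q)" using i j by simp
    then have prod_le: "p i * p j \<le> q * (p i + p j - q)"
      by (simp add: algebra_simps)
    have "entropy_nats (card A) (coeff (\<Prod>i\<in>A. [:1 - p i, p i:])) =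
        entropy_nats (card B + 2) (coeff ([:1 - p i, p i:] * ([:1 - p j, p j:] * R)))"
      unfolding cardA using B ij by (simp add: R_def)
    \<comment> \<open>Both new parameters lie strictly between \<open>p i\<close> and
      \<open>p j\<close>, hence strictly between 0 and 1.\<close>
    also have "\<dots> \<le> entropy_nats (card B + 2)
        (coeff ([:1 - q, q:] * ([:1 - (p i + p j - q), p i + p j - q:] * R)))"
      using i j pij prod_le by (intro entropy_mono_product R1) auto
    also have "\<dots> = entropy_nats (card A) (coeff (\<Prod>i\<in>A. [:1 - p' i, p' i:]))"
      unfolding cardA using B ij R' by (simp add: p'_def)
    also have "\<dots> \<le> entropy_nats (card A) (coeff ([:1 - q, q:] ^ card A))"
    proof (rule less.hyps)
      have "{i \<in> A. p' i \<noteq> q} \<subset> {i \<in> A. p i \<noteq> q}"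
        using i j ij by (auto simp: p'_def)
      then show "card {i \<in> A. p' i \<noteq> q} < card {i \<in> A. p i \<noteq> q}"
        using assms(1) by (intro psubset_card_mono) auto
      show "0 \<le> p' k \<and> p' k \<le> 1" if "k \<in> A" for k
        using that less.prems(1)[of k] i j pij by (auto simp: p'_def)
      have "(\<Sum>i\<in>B. p' i) = (\<Sum>i\<in>B. p i)" using p'B by (intro sum.cong) auto
      then have "(\<Sum>i\<in>A. p' i) = (\<Sum>i\<in>A. p i)"
        using B ij by (simp add: p'_def)
      then show "(\<Sum>i\<in>A. p' i) = real (card A) * q" using less.prems(2) by simp
    qed
    finally show ?thesis .
  qed
qed

section \<open>The entropy of the binomial distribution\<close>

text \<open>The expectation of \<open>f K\<close> for \<open>K\<close> binomial with
  \<open>n\<close> trials and success probability \<open>x\<close>.\<close>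

definition bernstein_mean :: "nat \<Rightarrow> (nat \<Rightarrow> real) \<Rightarrow> real \<Rightarrow> real" where
  "bernstein_mean n f x = (\<Sum>k\<le>n. Bernstein n k x * f k)"

lemma degree_linear_power_le: "degree ([:a, b:] ^ n) \<le> n"
  using degree_power_le[of "[:a, b:]" n] by (auto split: if_splits)

lemma coeff_linear_power_eq_Bernstein:
  "k \<le> n \<Longrightarrow> coeff ([:1 - x, x:] ^ n) k = Bernstein n k x"
proof (induction n arbitrary: k)
  case (Suc n)
  show ?case
  proof (cases k)
    case 0
    then show ?thesis
      unfolding power_Suc coeff_linear_mult using Suc.IH[of 0] by (simp add: Bernstein_def)
  next
    case (Suc j)
    have IHj: "coeff ([:1 - x, x:] ^ n) j = Bernstein n j x"
      using Suc.IH[of j] Suc.prems Suc by simp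
    show ?thesis
    proof (cases "k \<le> n")
      case True
      then have "n - j = Suc (n - Suc j)" using Suc by simp
      then have pw: "(1 - x) ^ (n - j) = (1 - x) * (1 - x) ^ (n - Suc j)" by simp
      have "coeff ([:1 - x, x:] ^ Suc n) k = (1 - x) * Bernstein n k x + x * Bernstein n j x"
        unfolding power_Suc coeff_linear_mult using Suc.IH[OF True] IHj Suc by simp
      also have "\<dots> = Bernstein (Suc n) k x"
        by (simp add: Bernstein_def Suc pw algebra_simps)
      finally show ?thesis .
    next
      case False
      then have "k = Suc n" using Suc.prems by simp
      then show ?thesis
        unfolding power_Suc coeff_linear_mult using IHj Suc coeff_eq_0[of "[:1 - x, x:] ^ n" k]
          degree_linear_power_le[of "1 - x" x n]
        by (simp add: Bernstein_def)
    qed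
  qed
qed (simp add: Bernstein_def)

lemma bernstein_mean_Suc:
  "bernstein_mean (Suc n) f x =
    (1 - x) * bernstein_mean n f x + x * bernstein_mean n (\<lambda>k. f (Suc k)) x"
proof -
  have "bernstein_mean (Suc n) f x = (\<Sum>k\<le>Suc n. coeff ([:1 - x, x:] * [:1 - x, x:] ^ n) k * f k)"
    unfolding bernstein_mean_def power_Suc[symmetric]
    by (intro sum.cong) (simp_all add: coeff_linear_power_eq_Bernstein del: power_Suc)
  also have "\<dots> = (\<Sum>k\<le>n. Bernstein n k x * ((1 - x) * f k + x * f (Suc k)))"
    unfolding sum_coeff_linear_mult[OF degree_linear_power_le]
    by (intro sum.cong) (simp_all add: coeff_linear_power_eq_Bernstein)
  finally show ?thesis
    by (simp add: bernstein_mean_def sum_distrib_left sum.distrib[symmetric] algebra_simps)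
qed

lemma bernstein_mean_diff:
  "bernstein_mean n (\<lambda>k. f k - g k) x = bernstein_mean n f x - bernstein_mean n g x"
  by (simp add: bernstein_mean_def sum_subtractf right_diff_distrib)

text \<open>The classical derivative of a Bernstein polynomial, by induction from the one-trial
  recursion \<open>bernstein_mean_Suc\<close>.\<close>

lemma DERIV_bernstein_mean:
  "(bernstein_mean (Suc n) f has_real_derivative
     real (Suc n) * bernstein_mean n (\<lambda>k. f (Suc k) - f k) x) (at x)"
proof (induction n arbitrary: f)
  case 0
  have "bernstein_mean (Suc 0) f = (\<lambda>x. (1 - x) * f 0 + x * f 1)"
    by (simp add: fun_eq_iff bernstein_mean_def Bernstein_def)
  then show ?case
    by (auto intro!: derivative_eq_intros simp: bernstein_mean_def Bernstein_def)
next
  case (Suc n)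
  have eq: "bernstein_mean (Suc (Suc n)) f =
      (\<lambda>x. (1 - x) * bernstein_mean (Suc n) f x + x * bernstein_mean (Suc n) (\<lambda>k. f (Suc k)) x)"
    by (rule ext, rule bernstein_mean_Suc)
  show ?case unfolding eq
    by (rule derivative_eq_intros Suc.IH refl)+
       (simp add: bernstein_mean_diff bernstein_mean_Suc[of n f]
         bernstein_mean_Suc[of n "\<lambda>k. f (Suc k)"] algebra_simps)
qed

text \<open>By absorption of \<open>n + 1\<close> and \<open>k + 1\<close> into the binomial
  coefficient, \<open>x\<close> times the left side is the probability of at least one success in
  \<open>n + 1\<close> trials.\<close>

lemma bernstein_mean_inverse_Suc_le:
  assumes "0 < x" "x < 1"
  shows "real (Suc n) * bernstein_mean n (\<lambda>k. 1 / real (Suc k)) x \<le> 1 / x"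
proof -
  have "x * (real (Suc n) * (Bernstein n k x * (1 / real (Suc k)))) = Bernstein (Suc n) (Suc k) x" for k
  proof -
    have "real (Suc k) * real (Suc n choose Suc k) = real (Suc n) * real (n choose k)"
      by (metis Suc_times_binomial of_nat_mult)
    then have "real (Suc n choose Suc k) = real (Suc n) * real (n choose k) / real (Suc k)"
      by (simp add: field_simps)
    then show ?thesis by (simp add: Bernstein_def)
  qed
  then have "x * (real (Suc n) * bernstein_mean n (\<lambda>k. 1 / real (Suc k)) x) =
      (\<Sum>k\<le>n. Bernstein (Suc n) (Suc k) x)"
    by (simp add: bernstein_mean_def sum_distrib_left)
  also have "\<dots> = 1 - Bernstein (Suc n) 0 x"
    using sum_Bernstein[of "Suc n" x] by (simp add: sum.atMost_Suc_shift del: sum.atMost_Suc sum_Bernstein)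
  also have "\<dots> \<le> 1" using assms by (simp add: Bernstein_nonneg)
  finally show ?thesis using assms by (simp add: field_simps)
qed

lemma bernstein_mean_reflect:
  "bernstein_mean n f (1 - x) = bernstein_mean n (\<lambda>k. f (n - k)) x"
  unfolding bernstein_mean_def
  by (rule sum.reindex_bij_witness[of _ "\<lambda>k. n - k" "\<lambda>k. n - k"])
     (auto simp: Bernstein_def binomial_symmetric[symmetric])

lemma bernstein_mean_mono:
  assumes "\<And>k. k \<le> n \<Longrightarrow> f k \<le> g k" "0 \<le> x" "x \<le> 1"
  shows "bernstein_mean n f x \<le> bernstein_mean n g x"
  unfolding bernstein_mean_def using assms
  by (intro sum_mono mult_left_mono Bernstein_nonneg) auto

section \<open>The sign of the slope\<close>

definition log_ratio :: "nat \<Rightarrow> nat \<Rightarrow> real" where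
  "log_ratio N k = ln (real (Suc k)) - ln (real (Suc N - k))"

text \<open>The derivative of the binomial entropy is \<open>n\<close> times this function with \<open>N = n - 1\<close>.\<close>
definition binomial_entropy_slope :: "nat \<Rightarrow> real \<Rightarrow> real" where
  "binomial_entropy_slope N x = ln (1 - x) - ln x + bernstein_mean N (log_ratio N) x"

text \<open>At \<open>1/2\<close> the variables \<open>K\<close> and \<open>N - K\<close> have the
  same law, while \<open>log_ratio N\<close> is odd under this reflection, so its mean equals its
  own negative.\<close>

lemma binomial_entropy_slope_half: "binomial_entropy_slope N (1/2) = 0"
proof -
  have "bernstein_mean N (log_ratio N) (1/2) = bernstein_mean N (\<lambda>k. log_ratio N (N - k)) (1/2)"
    using bernstein_mean_reflect[of N "log_ratio N" "1/2"] by simp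
  also have "\<dots> = bernstein_mean N (\<lambda>k. 0 - log_ratio N k) (1/2)"
    unfolding bernstein_mean_def
    by (intro sum.cong) (auto simp: log_ratio_def Suc_diff_le)
  also have "\<dots> = - bernstein_mean N (log_ratio N) (1/2)"
    unfolding bernstein_mean_diff by (simp add: bernstein_mean_def)
  finally show ?thesis by (simp add: binomial_entropy_slope_def)
qed

lemma log_ratio_diff_le:
  assumes "k \<le> M"
  shows "log_ratio (Suc M) (Suc k) - log_ratio (Suc M) k \<le> 1 / real (Suc k) + 1 / real (Suc (M - k))"
proof -
  have ln_step: "ln (real (Suc (Suc j))) - ln (real (Suc j)) \<le> 1 / real (Suc j)" for j
  proof -
    have "ln (real (Suc (Suc j))) - ln (real (Suc j)) =
        ln (real (Suc (Suc j)) / real (Suc j))"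
      by (simp add: ln_div del: of_nat_Suc)
    also have "real (Suc (Suc j)) / real (Suc j) = 1 + 1 / real (Suc j)"
      by (simp add: field_simps)
    also have "ln (1 + 1 / real (Suc j)) \<le> 1 / real (Suc j)" by (rule ln_add_one_self_le_self) simp
    finally show ?thesis .
  qed
  have "Suc (Suc M) - k = Suc (Suc (M - k))" "Suc (Suc M) - Suc k = Suc (M - k)"
    using assms by auto
  then show ?thesis
    using ln_step[of k] ln_step[of "M - k"] unfolding log_ratio_def by (simp del: of_nat_Suc)
qed

text \<open>The logarithms contribute \<open>- 1 / x - 1 / (1 - x)\<close>. The two reciprocals in
  \<open>log_ratio_diff_le\<close> have scaled means at most \<open>1 / x\<close> and
  \<open>1 / (1 - x)\<close>, which this just compensates.\<close>

lemma DERIV_binomial_entropy_slope: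
  assumes "0 < x" "x < 1"
  shows "\<exists>d. (binomial_entropy_slope N has_real_derivative d) (at x) \<and> d \<le> 0"
proof (cases N)
  case 0
  have eq: "binomial_entropy_slope N = (\<lambda>x. ln (1 - x) - ln x)"
    by (simp add: fun_eq_iff binomial_entropy_slope_def 0 bernstein_mean_def log_ratio_def)
  show ?thesis unfolding eq
    using assms by (intro exI[of _ "- 1 / (1 - x) - 1 / x"])
      (auto intro!: derivative_eq_intros simp: field_simps)
next
  case (Suc M)
  define D where "D = bernstein_mean M (\<lambda>k. log_ratio N (Suc k) - log_ratio N k) x"
  have "real (Suc M) * D \<le> real (Suc M) * bernstein_mean M (\<lambda>k. 1 / real (Suc k) + 1 / real (Suc (M - k))) x"
    unfolding D_def Suc using assms log_ratio_diff_le
    by (intro mult_left_mono bernstein_mean_mono) auto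
  \<comment> \<open>Reflection turns the mean of \<open>1 / (M - k + 1)\<close> at \<open>x\<close>
    into that of \<open>1 / (k + 1)\<close> at \<open>1 - x\<close>.\<close>
  also have "\<dots> = real (Suc M) * bernstein_mean M (\<lambda>k. 1 / real (Suc k)) x
      + real (Suc M) * bernstein_mean M (\<lambda>k. 1 / real (Suc k)) (1 - x)"
    unfolding bernstein_mean_reflect
    by (simp add: bernstein_mean_def sum.distrib distrib_left)
  also have "\<dots> \<le> 1 / x + 1 / (1 - x)"
    using assms by (intro add_mono bernstein_mean_inverse_Suc_le) auto
  finally have le: "real (Suc M) * D \<le> 1 / x + 1 / (1 - x)" .
  have "(binomial_entropy_slope N has_real_derivative
      (- 1 / (1 - x) - 1 / x + real (Suc M) * D)) (at x)"
    unfolding binomial_entropy_slope_def[abs_def] D_def Suc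
    using assms by (auto intro!: derivative_eq_intros DERIV_bernstein_mean simp: field_simps)
  then show ?thesis using le by (intro exI conjI) auto
qed

lemma binomial_entropy_slope_nonneg:
  assumes "0 < x" "x \<le> 1/2"
  shows "0 \<le> binomial_entropy_slope N x"
proof -
  have "binomial_entropy_slope N (1/2) \<le> binomial_entropy_slope N x"
    using assms DERIV_binomial_entropy_slope
    by (intro DERIV_nonpos_imp_nonincreasing[of x "1/2"]) auto
  then show ?thesis by (simp add: binomial_entropy_slope_half)
qed

section \<open>Binomial entropy as a function of the success probability\<close>

definition log_binomial :: "nat \<Rightarrow> nat \<Rightarrow> real" where
  "log_binomial n k = ln (real (n choose k))"

text \<open>The logarithm of a weight is \<open>log_binomial n k\<close> plus a term affine in
  \<open>k\<close>, and the latter only needs the binomial mean \<open>n * x\<close>.\<close>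

lemma entropy_nats_Bernstein:
  assumes "0 < x" "x < 1"
  shows "entropy_nats n (\<lambda>k. Bernstein n k x) =
    - bernstein_mean n (log_binomial n) x - real n * (x * ln x + (1 - x) * ln (1 - x))"
proof -
  have "Bernstein n k x * ln (Bernstein n k x) = Bernstein n k x * log_binomial n k
      + ln x * (real k * Bernstein n k x)
      + ln (1 - x) * (real n * Bernstein n k x - real k * Bernstein n k x)" if "k \<le> n" for k
  proof -
    have ln_eq: "ln (Bernstein n k x) = log_binomial n k + real k * ln x + (real n - real k) * ln (1 - x)"
      using assms that
      by (simp add: Bernstein_def log_binomial_def ln_mult ln_realpow of_nat_diff)
    show ?thesis unfolding ln_eq by (simp add: algebra_simps)
  qed
  then have "(\<Sum>k\<le>n. Bernstein n k x * ln (Bernstein n k x)) =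
     bernstein_mean n (log_binomial n) x
     + ln x * (\<Sum>k\<le>n. real k * Bernstein n k x)
     + ln (1 - x) * (real n * (\<Sum>k\<le>n. Bernstein n k x) - (\<Sum>k\<le>n. real k * Bernstein n k x))"
    by (simp add: bernstein_mean_def sum.distrib sum_distrib_left[symmetric] sum_subtractf
      del: sum_Bernstein sum_k_Bernstein)
  then show ?thesis by (simp add: entropy_nats_def algebra_simps)
qed

text \<open>Neighbouring binomial coefficients have quotient
  \<open>(N + 1 - k) / (k + 1)\<close>.\<close>

lemma log_binomial_diff:
  assumes "k \<le> N"
  shows "log_binomial (Suc N) (Suc k) - log_binomial (Suc N) k = - log_ratio N k"
proof -
  have "real (Suc N - k) * real (Suc N choose k) = real (Suc k) * real (Suc N choose Suc k)"
    using binomial_absorb_comp[of "Suc N" k] Suc_times_binomial[of k N]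
    by (metis (no_types, lifting) diff_Suc_1 of_nat_mult)
  then have "ln (real (Suc N - k) * real (Suc N choose k)) = ln (real (Suc k) * real (Suc N choose Suc k))"
    by simp
  moreover have "Suc N choose k > 0" "Suc N choose Suc k > 0" "Suc N - k > 0"
    using assms by (simp_all add: zero_less_binomial_iff del: binomial_Suc_Suc)
  ultimately show ?thesis
    by (simp add: ln_mult log_binomial_def log_ratio_def del: binomial_Suc_Suc of_nat_Suc)
qed

lemma DERIV_entropy_nats_Bernstein:
  assumes "0 < x" "x < 1"
  shows "((\<lambda>x. entropy_nats (Suc N) (\<lambda>k. Bernstein (Suc N) k x)) has_real_derivative
    real (Suc N) * binomial_entropy_slope N x) (at x)"
proof -
  have "bernstein_mean N (\<lambda>k. log_binomial (Suc N) (Suc k) - log_binomial (Suc N) k) x =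
      bernstein_mean N (\<lambda>k. 0 - log_ratio N k) x"
    unfolding bernstein_mean_def by (intro sum.cong) (auto simp: log_binomial_diff)
  also have "\<dots> = - bernstein_mean N (log_ratio N) x"
    unfolding bernstein_mean_diff by (simp add: bernstein_mean_def)
  finally have slope: "bernstein_mean N (\<lambda>k. log_binomial (Suc N) (Suc k) - log_binomial (Suc N) k) x
    = - bernstein_mean N (log_ratio N) x" .
  have "((\<lambda>x. x * ln x + (1 - x) * ln (1 - x)) has_real_derivative ln x - ln (1 - x)) (at x)"
    using assms by (auto intro!: derivative_eq_intros)
  from DERIV_diff[OF DERIV_minus[OF DERIV_bernstein_mean] DERIV_cmult[OF this]]
  have "((\<lambda>x. - bernstein_mean (Suc N) (log_binomial (Suc N)) x
      - real (Suc N) * (x * ln x + (1 - x) * ln (1 - x))) has_real_derivative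
    real (Suc N) * binomial_entropy_slope N x) (at x)"
    by (rule DERIV_cong) (simp only: slope binomial_entropy_slope_def algebra_simps)
  then show ?thesis
  \<comment> \<open>The closed form was proved only in the open unit interval, which suffices for a
    derivative there.\<close>
  proof (rule has_field_derivative_transform_within_open[of _ _ _ "{0<..<1}"])
    show "- bernstein_mean (Suc N) (log_binomial (Suc N)) y
        - real (Suc N) * (y * ln y + (1 - y) * ln (1 - y)) =
      entropy_nats (Suc N) (\<lambda>k. Bernstein (Suc N) k y)" if "y \<in> {0<..<1}" for y
      using that by (simp add: entropy_nats_Bernstein)
  qed (use assms in auto)
qed

lemma entropy_nats_nonneg:
  assumes "\<And>k. k \<le> n \<Longrightarrow> 0 \<le> c k \<and> c k \<le> 1"
  shows "0 \<le> entropy_nats n c"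
proof -
  have "c k * ln (c k) \<le> 0" if "k \<le> n" for k
    using assms[OF that] by (cases "c k = 0") (auto intro!: mult_nonneg_nonpos)
  then show ?thesis by (auto simp: entropy_nats_def intro!: sum_nonpos)
qed

lemma entropy_nats_Bernstein_reflect:
  "entropy_nats n (\<lambda>k. Bernstein n k (1 - x)) = entropy_nats n (\<lambda>k. Bernstein n k x)"
  unfolding entropy_nats_def
  by (intro arg_cong[of _ _ uminus] sum.reindex_bij_witness[of _ "\<lambda>k. n - k" "\<lambda>k. n - k"])
     (auto simp: Bernstein_def binomial_symmetric[symmetric] mult_ac)

text \<open>The slope makes the entropy nondecreasing on each \<open>[y, 1/2]\<close> with
  \<open>y > 0\<close>. At \<open>y = 0\<close> it is zero, and arguments above \<open>1/2\<close>
  are reflected.\<close>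

lemma entropy_nats_Bernstein_le_half:
  assumes "0 \<le> x" "x \<le> 1"
  shows "entropy_nats n (\<lambda>k. Bernstein n k x) \<le> entropy_nats n (\<lambda>k. Bernstein n k (1/2))"
proof -
  have le: "entropy_nats n (\<lambda>k. Bernstein n k y) \<le> entropy_nats n (\<lambda>k. Bernstein n k (1/2))"
    if y: "0 \<le> y" "y \<le> 1/2" for y
  proof (cases n)
    case 0
    then show ?thesis by (simp add: entropy_nats_def Bernstein_def)
  next
    case (Suc N)
    show ?thesis
    proof (cases "y = 0")
      case True
      have "entropy_nats n (\<lambda>k. Bernstein n k y) = 0"
        unfolding entropy_nats_def neg_equal_0_iff_equal
        by (intro sum.neutral) (simp add: Bernstein_def True power_0_left)
      moreover have "Bernstein n k (1/2) \<le> 1" if "k \<le> n" for k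
        using that member_le_sum[of k "{..n}" "\<lambda>k. Bernstein n k (1/2)"]
        by (simp add: Bernstein_nonneg)
      then have "0 \<le> entropy_nats n (\<lambda>k. Bernstein n k (1/2))"
        by (intro entropy_nats_nonneg) (auto simp: Bernstein_nonneg)
      ultimately show ?thesis by simp
    next
      case False
      show ?thesis unfolding Suc
      proof (rule DERIV_nonneg_imp_nondecreasing[of y "1/2"])
        fix z assume "y \<le> z" "z \<le> 1/2"
        then show "\<exists>d. ((\<lambda>x. entropy_nats (Suc N) (\<lambda>k. Bernstein (Suc N) k x))
            has_real_derivative d) (at z) \<and> 0 \<le> d"
          using False y binomial_entropy_slope_nonneg[of z N]
          by (intro exI[of _ "real (Suc N) * binomial_entropy_slope N z"] conjI
              DERIV_entropy_nats_Bernstein) auto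
      qed (use y in auto)
    qed
  qed
  show ?thesis
  proof (cases "x \<le> 1/2")
    case False
    then show ?thesis
      using le[of "1 - x"] assms by (simp add: entropy_nats_Bernstein_reflect)
  qed (use le assms in auto)
qed

section \<open>Sums of independent Bernoulli variables\<close>

text \<open>The polynomial is the probability generating function: adjoining an independent variable
  multiplies it by a linear factor.\<close>

lemma (in prob_space) prob_sum_bernoulli:
  fixes X :: "'i \<Rightarrow> 'a \<Rightarrow> nat"
  assumes "finite A" "indep_vars (\<lambda>_. count_space UNIV) X A"
    and "\<And>i \<omega>. i \<in> A \<Longrightarrow> \<omega> \<in> space M \<Longrightarrow> X i \<omega> \<in> {0, 1}"
    and "\<And>i. i \<in> A \<Longrightarrow> prob {\<omega> \<in> space M. X i \<omega> = 1} = p i"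
    and "\<And>i. i \<in> A \<Longrightarrow> prob {\<omega> \<in> space M. X i \<omega> = 0} = 1 - p i"
  shows "prob {\<omega> \<in> space M. (\<Sum>i\<in>A. X i \<omega>) = k} = coeff (\<Prod>i\<in>A. [:1 - p i, p i:]) k"
  using assms
proof (induction A arbitrary: k rule: finite_induct)
  case empty
  show ?case by (auto simp: prob_space coeff_1 split: nat.split)
next
  case (insert i A)
  let ?S = "\<lambda>\<omega>. \<Sum>i\<in>A. X i \<omega>"
  have IH: "prob {\<omega> \<in> space M. ?S \<omega> = k} = coeff (\<Prod>i\<in>A. [:1 - p i, p i:]) k" for k
    using insert.prems by (intro insert.IH) (auto intro: indep_vars_subset)
  \<comment> \<open>\<open>indep_vars_sum\<close> concerns real variables; \<open>joint\<close>
    translates the events back to naturals.\<close>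
  have "indep_vars (\<lambda>_. borel) (\<lambda>i \<omega>. real (X i \<omega>)) (insert i A)"
    by (rule indep_vars_compose2[OF insert.prems(1)]) simp
  from indep_vars_sum[OF insert.hyps this]
  have ind: "indep_var borel (\<lambda>\<omega>. real (X i \<omega>)) borel (\<lambda>\<omega>. \<Sum>i\<in>A. real (X i \<omega>))" .
  have joint: "prob {\<omega> \<in> space M. X i \<omega> = a \<and> ?S \<omega> = b} =
      prob {\<omega> \<in> space M. X i \<omega> = a} * prob {\<omega> \<in> space M. ?S \<omega> = b}" for a b
  proof -
    have "prob ((\<lambda>\<omega>. (real (X i \<omega>), \<Sum>i\<in>A. real (X i \<omega>))) -` ({real a} \<times> {real b}) \<inter> space M) =
       prob ((\<lambda>\<omega>. real (X i \<omega>)) -` {real a} \<inter> space M) *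
       prob ((\<lambda>\<omega>. \<Sum>i\<in>A. real (X i \<omega>)) -` {real b} \<inter> space M)"
      by (rule indep_varD[OF ind]) auto
    also have "(\<lambda>\<omega>. (real (X i \<omega>), \<Sum>i\<in>A. real (X i \<omega>))) -` ({real a} \<times> {real b}) \<inter> space M =
        {\<omega> \<in> space M. X i \<omega> = a \<and> ?S \<omega> = b}"
      by (auto simp flip: of_nat_sum)
    also have "(\<lambda>\<omega>. real (X i \<omega>)) -` {real a} \<inter> space M = {\<omega> \<in> space M. X i \<omega> = a}"
      by auto
    also have "(\<lambda>\<omega>. \<Sum>i\<in>A. real (X i \<omega>)) -` {real b} \<inter> space M = {\<omega> \<in> space M. ?S \<omega> = b}"
      by (auto simp flip: of_nat_sum)
    finally show ?thesis .
  qed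
  have meas: "X j \<in> measurable M (count_space UNIV)" if "j \<in> insert i A" for j
    using insert.prems(1) that by (auto simp: indep_vars_def)
  have [measurable]: "X i \<in> measurable M (count_space UNIV)" by (rule meas) simp
  have [measurable]: "?S \<in> measurable M (count_space UNIV)"
    by (rule measurable_sum_nat) (auto intro: meas)
  have P: "(\<Prod>i\<in>insert i A. [:1 - p i, p i:]) = [:1 - p i, p i:] * (\<Prod>i\<in>A. [:1 - p i, p i:])"
    using insert.hyps by simp
  have X01: "X i \<omega> = 0 \<or> X i \<omega> = 1" if "\<omega> \<in> space M" for \<omega>
    using insert.prems(2)[of i \<omega>] that by auto
  have sumI: "(\<Sum>i\<in>insert i A. X i \<omega>) = X i \<omega> + ?S \<omega>" for \<omega>
    using insert.hyps by simp
  show ?case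
  proof (cases k)
    case 0
    have "{\<omega> \<in> space M. (\<Sum>i\<in>insert i A. X i \<omega>) = k} = {\<omega> \<in> space M. X i \<omega> = 0 \<and> ?S \<omega> = 0}"
      unfolding sumI 0 by auto
    then show ?thesis
      unfolding P coeff_linear_mult using joint[of 0 0] insert.prems(4)[of i] IH[of 0] 0 by simp
  next
    case (Suc j)
    have "{\<omega> \<in> space M. (\<Sum>i\<in>insert i A. X i \<omega>) = k} =
        {\<omega> \<in> space M. X i \<omega> = 0 \<and> ?S \<omega> = k} \<union> {\<omega> \<in> space M. X i \<omega> = 1 \<and> ?S \<omega> = j}"
      unfolding sumI Suc using X01 by force
    also have "prob \<dots> = prob {\<omega> \<in> space M. X i \<omega> = 0 \<and> ?S \<omega> = k} +
        prob {\<omega> \<in> space M. X i \<omega> = 1 \<and> ?S \<omega> = j}"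
      by (rule finite_measure_Union) auto
    finally show ?thesis
      unfolding P coeff_linear_mult joint
      using insert.prems(3,4)[of i] IH[of k] IH[of j] Suc by simp
  qed
qed

lemma shannon_entropy_sum_bernoulli:
  assumes "indep_bernoulli M n p X"
  shows "shannon_entropy M (\<lambda>\<omega>. \<Sum>i = 1..n. X i \<omega>) =
    entropy_nats n (coeff (\<Prod>i = 1..n. [:1 - p i, p i:])) / ln 2"
proof -
  interpret prob_space M using assms by (simp add: indep_bernoulli_def)
  let ?S = "\<lambda>\<omega>. \<Sum>i = 1..n. X i \<omega>"
  let ?c = "coeff (\<Prod>i = 1..n. [:1 - p i, p i:])"
  have X: "indep_vars (\<lambda>_. count_space UNIV) X {1..n}"
    "\<And>i \<omega>. i \<in> {1..n} \<Longrightarrow> \<omega> \<in> space M \<Longrightarrow> X i \<omega> \<in> {0, 1}"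
    "\<And>i. i \<in> {1..n} \<Longrightarrow> prob {\<omega> \<in> space M. X i \<omega> = 1} = p i"
    "\<And>i. i \<in> {1..n} \<Longrightarrow> prob {\<omega> \<in> space M. X i \<omega> = 0} = 1 - p i"
    using assms by (auto simp: indep_bernoulli_def)
  have prob: "prob {\<omega> \<in> space M. ?S \<omega> = k} = ?c k" for k
    by (rule prob_sum_bernoulli[OF _ X]) auto
  have "?S \<omega> \<le> (\<Sum>i = 1..n. 1)" if "\<omega> \<in> space M" for \<omega>
    using X(2) that by (intro sum_mono) fastforce
  then have range: "?S ` space M \<subseteq> {..n}" by auto
  have meas: "?S \<in> measurable M (count_space UNIV)"
    using X(1) by (intro measurable_sum_nat) (auto simp: indep_vars_def)
  have "simple_function M ?S"
    unfolding simple_function_def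
  proof (intro conjI ballI)
    show "finite (?S ` space M)" using range finite_subset by blast
    show "?S -` {k} \<inter> space M \<in> sets M" for k
      using measurable_sets[OF meas, of "{k}"] by simp
  qed
  then have "shannon_entropy M ?S = - (\<Sum>k\<in>?S ` space M. ?c k * log 2 (?c k))"
    unfolding prob[symmetric] by (rule shannon_entropy_eq_sum[OF prob_space_axioms])
  \<comment> \<open>Values up to \<open>n\<close> that are not attained have probability 0 and
    contribute nothing.\<close>
  also have "(\<Sum>k\<in>?S ` space M. ?c k * log 2 (?c k)) = (\<Sum>k\<le>n. ?c k * log 2 (?c k))"
  proof (rule sum.mono_neutral_left)
    show "\<forall>k\<in>{..n} - ?S ` space M. ?c k * log 2 (?c k) = 0"
    proof
      fix k assume "k \<in> {..n} - ?S ` space M"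
      then have empty: "{\<omega> \<in> space M. ?S \<omega> = k} = {}" by auto
      show "?c k * log 2 (?c k) = 0" unfolding prob[symmetric] empty by simp
    qed
  qed (use range in auto)
  finally show ?thesis
    by (simp add: entropy_nats_def log_def sum_divide_distrib)
qed

section \<open>The bound, the case of equality and its realization\<close>

lemma binomial_entropy_eq_entropy_nats:
  "binomial_entropy n x = entropy_nats n (\<lambda>k. Bernstein n k x) / ln 2"
  by (simp add: binomial_entropy_def entropy_nats_def Bernstein_def log_def sum_divide_distrib
    atLeast0AtMost)

lemma entropy_nats_linear_power:
  "entropy_nats n (coeff ([:1 - x, x:] ^ n)) = entropy_nats n (\<lambda>k. Bernstein n k x)"
  by (simp add: entropy_nats_def coeff_linear_power_eq_Bernstein)

lemma shannon_entropy_sum_bernoulli_le: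
  assumes p: "\<forall>i\<in>{1..n}. 0 \<le> p i \<and> p i \<le> 1" and "indep_bernoulli M n p X"
  shows "shannon_entropy M (\<lambda>\<omega>. \<Sum>i = 1..n. X i \<omega>) \<le> binomial_entropy n (1/2)"
proof -
  define q where "q = (\<Sum>i = 1..n. p i) / real n"
  have q: "(\<Sum>i = 1..n. p i) = real n * q"
    by (cases "n = 0") (auto simp: q_def)
  have "(\<Sum>i = 1..n. p i) \<le> (\<Sum>i = 1..n. 1)" using p by (intro sum_mono) auto
  then have q01: "0 \<le> q" "q \<le> 1"
    using p by (auto simp: q_def divide_le_eq intro!: divide_nonneg_nonneg sum_nonneg)
  have "entropy_nats n (coeff (\<Prod>i = 1..n. [:1 - p i, p i:])) \<le> entropy_nats n (coeff ([:1 - q, q:] ^ n))"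
    using entropy_prod_linear_le_power[of "{1..n}" p q] p q by simp
  also have "\<dots> \<le> entropy_nats n (\<lambda>k. Bernstein n k (1/2))"
    unfolding entropy_nats_linear_power by (rule entropy_nats_Bernstein_le_half[OF q01])
  finally show ?thesis
    unfolding shannon_entropy_sum_bernoulli[OF assms(2)] binomial_entropy_eq_entropy_nats
    by (intro divide_right_mono) auto
qed

lemma shannon_entropy_sum_fair:
  assumes "\<forall>i\<in>{1..n}. p i = 1/2" and "indep_bernoulli M n p X"
  shows "shannon_entropy M (\<lambda>\<omega>. \<Sum>i = 1..n. X i \<omega>) = binomial_entropy n (1/2)"
proof -
  have "(\<Prod>i = 1..n. [:1 - p i, p i:]) = (\<Prod>i = 1..n. [:1 - 1/2, 1/2:])"
    using assms(1) by (intro prod.cong) auto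
  also have "\<dots> = [:1 - 1/2, 1/2:] ^ n" by simp
  finally show ?thesis
    unfolding shannon_entropy_sum_bernoulli[OF assms(2)] binomial_entropy_eq_entropy_nats
    by (simp only: entropy_nats_linear_power)
qed

text \<open>Needed for the maximum to be attained: fair coins are realized as coordinates of a
  product distribution.\<close>

lemma exists_indep_fair_bernoulli:
  "\<exists>M X. indep_bernoulli (M :: (nat \<Rightarrow> nat) measure) n (\<lambda>_. 1/2) X"
proof -
  define D where "D = map_pmf (of_bool :: bool \<Rightarrow> nat) (bernoulli_pmf (1/2))"
  define P where "P = Pi_pmf {1..n} 0 (\<lambda>_. D)"
  \<comment> \<open>The sample space contains all functions, so coordinates are truncated to be 0 or
    1 everywhere and not merely almost surely.\<close>
  define X :: "nat \<Rightarrow> (nat \<Rightarrow> nat) \<Rightarrow> nat" where "X = (\<lambda>i \<omega>. if \<omega> i = 1 then 1 else 0)"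
  have "prob_space.indep_vars P (\<lambda>_. count_space UNIV) (\<lambda>i \<omega>. \<omega> i) {1..n}"
    unfolding P_def by (rule indep_vars_Pi_pmf) simp
  then have indep: "prob_space.indep_vars P (\<lambda>_. count_space UNIV) X {1..n}"
    unfolding X_def
    by (rule prob_space.indep_vars_compose2[OF measure_pmf.prob_space_axioms]) simp
  have marginal: "measure P {\<omega>. \<omega> i \<in> S} = measure (bernoulli_pmf (1/2)) (of_bool -` S)"
    if "i \<in> {1..n}" for i S
  proof -
    have "measure P {\<omega>. \<omega> i \<in> S} = measure (map_pmf (\<lambda>\<omega>. \<omega> i) P) S"
      by (simp add: measure_map_pmf vimage_def)
    also have "map_pmf (\<lambda>\<omega>. \<omega> i) P = D"
      using that by (simp add: P_def Pi_pmf_component)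
    finally show ?thesis by (simp add: D_def measure_map_pmf)
  qed
  \<comment> \<open>\<open>X i\<close> is 0 exactly where the coordinate differs from 1, hence the
    complement.\<close>
  have "(of_bool :: bool \<Rightarrow> nat) -` {1} = {True}" "(of_bool :: bool \<Rightarrow> nat) -` (- {1}) = {False}"
    by (auto simp: of_bool_def split: if_splits)
  then have "measure P {\<omega>. X i \<omega> = 1} = 1/2 \<and> measure P {\<omega>. X i \<omega> = 0} = 1/2"
    if "i \<in> {1..n}" for i
    using marginal[OF that, of "{1}"] marginal[OF that, of "- {1}"]
    by (simp add: X_def measure_pmf_single if_distrib[of "\<lambda>x. x = _"] cong: if_cong)
  then have "indep_bernoulli P n (\<lambda>_. 1/2) X"
    using indep by (auto simp: indep_bernoulli_def X_def measure_pmf.prob_space_axioms)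
  then show ?thesis by blast
qed

theorem theorem3:
  fixes n :: nat
  assumes "n \<ge> 1"
  shows
    "(\<forall>(M :: 'a measure) (X :: nat \<Rightarrow> 'a \<Rightarrow> nat) (p :: nat \<Rightarrow> real).
        (\<forall>i\<in>{1..n}. 0 \<le> p i \<and> p i \<le> 1) \<longrightarrow> indep_bernoulli M n p X \<longrightarrow>
          shannon_entropy M (\<lambda>\<omega>. \<Sum>i = 1..n. X i \<omega>) \<le> binomial_entropy n (1/2) \<and>
          ((\<forall>i\<in>{1..n}. p i = 1/2) \<longrightarrow>
            shannon_entropy M (\<lambda>\<omega>. \<Sum>i = 1..n. X i \<omega>) = binomial_entropy n (1/2)))
     \<and> is_maximum
        {shannon_entropy M (\<lambda>\<omega>. \<Sum>i = 1..n. X i \<omega>) |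
           (M :: (nat \<Rightarrow> nat) measure) (X :: nat \<Rightarrow> (nat \<Rightarrow> nat) \<Rightarrow> nat) (p :: nat \<Rightarrow> real).
           (\<forall>i\<in>{1..n}. 0 \<le> p i \<and> p i \<le> 1) \<and> indep_bernoulli M n p X}
        (binomial_entropy n (1/2))"
proof -
  let ?V = "{shannon_entropy M (\<lambda>\<omega>. \<Sum>i = 1..n. X i \<omega>) |
      (M :: (nat \<Rightarrow> nat) measure) (X :: nat \<Rightarrow> (nat \<Rightarrow> nat) \<Rightarrow> nat) (p :: nat \<Rightarrow> real).
      (\<forall>i\<in>{1..n}. 0 \<le> p i \<and> p i \<le> 1) \<and> indep_bernoulli M n p X}"
  \<comment> \<open>A general type \<open>'a\<close> may be too small to carry fair coins, so
    attainment is shown on functions from \<open>nat\<close> to \<open>nat\<close>.\<close>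
  obtain M X where M: "indep_bernoulli (M :: (nat \<Rightarrow> nat) measure) n (\<lambda>_. 1/2) X"
    using exists_indep_fair_bernoulli by blast
  have half: "\<forall>i\<in>{1..n}. 0 \<le> (1/2 :: real) \<and> 1/2 \<le> (1 :: real)" by simp
  have "binomial_entropy n (1/2) = shannon_entropy M (\<lambda>\<omega>. \<Sum>i = 1..n. X i \<omega>)"
    using shannon_entropy_sum_fair[OF _ M] by simp
  then have "binomial_entropy n (1/2) \<in> ?V"
    by (intro CollectI exI[of _ M] exI[of _ X] exI[of _ "\<lambda>_. 1/2"] conjI M half)
  moreover have "\<forall>v \<in> ?V. v \<le> binomial_entropy n (1/2)"
    by (intro ballI, elim CollectE exE conjE) (simp only: shannon_entropy_sum_bernoulli_le)
  ultimately have "is_maximum ?V (binomial_entropy n (1/2))"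
    unfolding is_maximum_def by (rule conjI)
  then show ?thesis
    using shannon_entropy_sum_bernoulli_le shannon_entropy_sum_fair
    by (intro conjI allI impI) simp_all
qed

end
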